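(* Let $p(z,x_1,\dots,x_n)=c_d(x_1,\dots,x_n)z^d+c_{d-1}(x_1,\dots,x_n)z^{d-1}+\dots+c_0(x_1,\dots,x_n)$ be a polynomial in $z$ of degree $d$, whose coefficients $c_i$ are polynomials in $x_1,\dots,x_n$. Let $p^{(i)}$ denote the $i$-th derivative of $p$ with respect to $z$. Define $$A=\left\{a\in\mathbb{R}^n \;\middle|\; \operatorname{Res}_z\left(p,p^{(i)}\right)(a)\neq 0,\ i=1,\dots,d\right\}.$$ Then $A$ is an open subset of $\mathbb{R}^n$ such that for each connected component $C$ of $A$: (1) There exist continuous functions $r_1(x_1,\dots,x_n)<\dots<r_k(x_1,\dots,x_n)$ on $C$ such that, for each $a\in C$, the real roots of $p(z,a)$ in $z$ are $\{r_1(a),\dots,r_k(a)\}$. (2) For each $i=1,\dots,d$ and $j=1,\dots,k$, $\operatorname{sign}\left(p^{(i)}(r_j(x_1,\dots,x_n),x_1,\dots,x_n)\right)$ is constant and nonzero on $C$. (3) Let $\sigma_{i,j}:=\operatorname{sign}\left(p^{(i)}(r_j(x_1,\dots,x_n),x_1,\dots,x_n)\right)$ be this constant sign. Then, for $(x_1,\dots,x_n)\in C$, $z\in\mathbb{R}$ and $j=1,\dots,k$, we have $z=r_j(x_1,\dots,x_n)$ if and only if $$p(z,x_1,\dots,x_n)=0\ \land\ \operatorname{sign}(p'(z,x_1,\dots,x_n))=\sigma_{1,j}\ \land\ \dots\ \land\ \operatorname{sign}(p^{(d)}(z,x_1,\dots,x_n))=\sigma_{d,j}.$$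
   Context: Polynomials have rational coefficients. For polynomials $p,q$ viewed as polynomials in $z$ of degrees $d$ and $e$ (with coefficients that are polynomials in $x_1,\dots,x_n$), $\operatorname{Res}_z(p,q)$ is the determinant of the $(d+e)\times(d+e)$ Sylvester matrix, whose rows are $z^{e-1}p,\dots,p,z^{d-1}q,\dots,q$ written as coefficient vectors in the basis $z^{d+e-1},\dots,z,1$; it is a polynomial in $x_1,\dots,x_n$, and $\operatorname{Res}_z(p,q)(a)$ is its value at $a\in\mathbb{R}^n$. The function $\operatorname{sign}$ takes values in $\{-1,0,1\}$. The number $k$ of roots may depend on the component $C$ (and may be $0$). *)

theory Defs
  imports
    "HOL-Analysis.Analysis"
    "HOL-Library.Poly_Mapping"
    "Subresultants.Resultant_Prelim"
begin

text \<open>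
  Polynomials over the rationals whose variables are indexed by \<open>'n\<close>: a monomial is its exponent
  vector, and a polynomial maps each monomial to its coefficient, with finite support. Addition and
  multiplication are the instances for \<open>poly_mapping\<close> (multiplication is convolution).
  A linear order on \<open>'n\<close> is assumed below only because the library derives the integral domain
  instance, which \<open>pderiv\<close> requires, under that assumption.
\<close>

type_synonym 'n mpoly_rat = "('n \<Rightarrow>\<^sub>0 nat) \<Rightarrow>\<^sub>0 rat"

definition mpoly_eval :: "real ^ 'n \<Rightarrow> 'n::finite mpoly_rat \<Rightarrow> real" where
  "mpoly_eval a f =
     (\<Sum>m\<in>Poly_Mapping.keys f. of_rat (Poly_Mapping.lookup f m) * (\<Prod>i\<in>UNIV. vec_nth a i ^ Poly_Mapping.lookup m i))"

text \<open>
  For \<open>p\<close> a polynomial in \<open>z\<close> with coefficients in the above ring, \<open>specialize a p\<close> is the real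
  polynomial \<open>p(z, a)\<close> in \<open>z\<close>. Its degree may be smaller than that of \<open>p\<close>.
\<close>

definition specialize :: "real ^ 'n \<Rightarrow> 'n::finite mpoly_rat poly \<Rightarrow> real poly" where
  "specialize a p = map_poly (mpoly_eval a) p"

end

theory Submission
  imports Defs
begin

text \<open>
  On \<open>A\<close> the leading coefficient of \<open>p(z, a)\<close> does not vanish (case \<open>i = d\<close>), and no derivative vanishes
  at a real root. By Thom's lemma a root is then determined by the signs of the derivatives at it.
  For a fixed sign vector, the set of \<open>a \<in> C\<close> such that \<open>p(z, a)\<close> has a root with these signs is open (the
  root is simple, so it persists under perturbation) and closed in \<open>C\<close> (the roots are locally bounded,
  and no sign can become zero in the limit), hence empty or all of \<open>C\<close>. So each root over a base point
  extends to a function on \<open>C\<close> through its sign vector; persistence makes it continuous, and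
  connectedness preserves the order of the roots.
\<close>

section \<open>Evaluation at a real point as a ring homomorphism\<close>

text \<open>Monomials outside the support contribute zero. This allows two polynomials with
  different supports to be evaluated over a common index set.\<close>

lemma mpoly_eval_superset:
  assumes "finite S" "Poly_Mapping.keys f \<subseteq> S"
  shows "mpoly_eval a f =
    (\<Sum>m\<in>S. of_rat (Poly_Mapping.lookup f m) * (\<Prod>i\<in>UNIV. vec_nth a i ^ Poly_Mapping.lookup m i))"
  unfolding mpoly_eval_def
  by (rule sum.mono_neutral_left) (use assms in \<open>auto simp: in_keys_iff\<close>)

lemma mpoly_eval_0 [simp]: "mpoly_eval a 0 = 0"
  by (simp add: mpoly_eval_def)

lemma mpoly_eval_add: "mpoly_eval a (f + g) = mpoly_eval a f + mpoly_eval a g"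
proof -
  let ?S = "Poly_Mapping.keys f \<union> Poly_Mapping.keys g"
  have "Poly_Mapping.keys (f + g) \<subseteq> ?S"
    by (auto simp: in_keys_iff lookup_add)
  then show ?thesis
    by (simp add: mpoly_eval_superset[of ?S] lookup_add of_rat_add distrib_right sum.distrib)
qed

lemma mpoly_eval_sum: "mpoly_eval a (sum f S) = (\<Sum>x\<in>S. mpoly_eval a (f x))"
  by (induction S rule: infinite_finite_induct) (auto simp: mpoly_eval_add)

lemma mpoly_eval_single:
  "mpoly_eval a (Poly_Mapping.single m c) = of_rat c * (\<Prod>i\<in>UNIV. vec_nth a i ^ Poly_Mapping.lookup m i)"
  by (subst mpoly_eval_superset[of "{m}"]) auto

lemma poly_mapping_sum_singles:
  fixes f :: "'a \<Rightarrow>\<^sub>0 'b::comm_monoid_add"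
  shows "f = (\<Sum>m\<in>Poly_Mapping.keys f. Poly_Mapping.single m (Poly_Mapping.lookup f m))"
  by (rule poly_mapping_eqI) (auto simp: lookup_sum lookup_single when_def in_keys_iff)

text \<open>Expanding both factors into monomials reduces the claim to products of two monomials,
  where exponents add and coefficients multiply.\<close>

lemma mpoly_eval_mult: "mpoly_eval a (f * g) = mpoly_eval a f * mpoly_eval a g"
proof -
  let ?F = "Poly_Mapping.keys f" and ?G = "Poly_Mapping.keys g"
  let ?f = "Poly_Mapping.lookup f" and ?g = "Poly_Mapping.lookup g"
  have "f * g = (\<Sum>m\<in>?F. \<Sum>n\<in>?G. Poly_Mapping.single (m + n) (?f m * ?g n))"
    by (subst poly_mapping_sum_singles[of f], subst poly_mapping_sum_singles[of g])
       (simp add: sum_product mult_single)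
  then have "mpoly_eval a (f * g) = (\<Sum>m\<in>?F. \<Sum>n\<in>?G. 
      mpoly_eval a (Poly_Mapping.single m (?f m)) * mpoly_eval a (Poly_Mapping.single n (?g n)))"
    by (simp add: mpoly_eval_sum mpoly_eval_single lookup_add power_add prod.distrib of_rat_mult mult_ac)
  then show ?thesis
    unfolding sum_product[symmetric] by (simp add: mpoly_eval_single mpoly_eval_def[symmetric])
qed

lemma mpoly_eval_1: "mpoly_eval a 1 = 1"
  unfolding single_one[symmetric] mpoly_eval_single by simp

lemma idom_hom_mpoly_eval: 
  "idom_hom (mpoly_eval a :: 'n::{finite,linorder} mpoly_rat \<Rightarrow> real)"
  by unfold_locales (auto simp: mpoly_eval_add mpoly_eval_mult mpoly_eval_1)

lemma continuous_on_mpoly_eval: "continuous_on S (\<lambda>a. mpoly_eval a f)"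
  unfolding mpoly_eval_def by (intro continuous_intros)

section \<open>Sylvester matrices and common roots\<close>

text \<open>Row \<open>l\<close> of a block holds the coefficients of z^(n-1-l) * p, so pairing it
  with the powers of \<open>z\<close> evaluates that polynomial. The format \<open>m\<close> only
  bounds the degree, since specialization may lower it. Exchanging \<open>m\<close> and
  \<open>n\<close> gives the rows of the second block.\<close>

lemma sum_sylvester_row:
  fixes z :: "'a::comm_ring_1"
  assumes "degree p \<le> m" "l < n"
  shows "(\<Sum>j<m + n. (if l \<le> j \<and> j - l \<le> m then coeff p (m + l - j) else 0) * z ^ (m + n - 1 - j))
    = z ^ (n - 1 - l) * poly p z"
proof -
  have "(\<Sum>j<m + n. (if l \<le> j \<and> j - l \<le> m then coeff p (m + l - j) else 0) * z ^ (m + n - 1 - j))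
    = (\<Sum>j\<in>{l..m + l}. coeff p (m + l - j) * z ^ (m + n - 1 - j))"
    using assms by (intro sum.mono_neutral_cong_right) auto
  also have "\<dots> = (\<Sum>k\<le>m. coeff p k * z ^ (n - 1 - l + k))"
    using assms by (intro sum.reindex_bij_witness[of _ "\<lambda>k. m + l - k" "\<lambda>j. m + l - j"])
      (auto intro!: arg_cong[of _ _ "\<lambda>e. _ * z ^ e"])
  also have "\<dots> = z ^ (n - 1 - l) * (\<Sum>k\<le>m. coeff p k * z ^ k)"
    by (simp add: sum_distrib_left power_add mult_ac)
  also have "(\<Sum>k\<le>m. coeff p k * z ^ k) = poly p z"
    unfolding poly_altdef using assms
    by (intro sum.mono_neutral_right) (auto simp: coeff_eq_0)
  finally show ?thesis .
qed

text \<open>A common root \<open>z\<close> makes \<open>(z\<^bsup>m+n-1\<^esup>, \<dots>, z, 1)\<close> a kernel vector of the Sylvester matrix.\<close>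

lemma det_sylvester_mat_sub_common_root:
  fixes z :: "'a::idom"
  assumes "degree p \<le> m" "degree q \<le> n" "0 < m + n" "poly p z = 0" "poly q z = 0"
  shows "det (sylvester_mat_sub m n p q) = 0"
proof -
  let ?N = "m + n" and ?S = "sylvester_mat_sub m n p q"
  define v where "v = Matrix.vec ?N (\<lambda>j. z ^ (?N - 1 - j))"
  have "?S *\<^sub>v v = 0\<^sub>v ?N"
  proof (rule eq_vecI)
    fix i assume "i < dim_vec (0\<^sub>v ?N :: 'a Matrix.vec)"
    then have i: "i < ?N" by simp
    have "vec_index (?S *\<^sub>v v) i = (\<Sum>j<?N. ?S $$ (i, j) * z ^ (?N - 1 - j))"
      using i by (simp add: v_def scalar_prod_def lessThan_atLeast0)
    also have "\<dots> = 0"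
    proof (cases "i < n")
      case True
      have "(\<Sum>j<?N. ?S $$ (i, j) * z ^ (?N - 1 - j)) = z ^ (n - 1 - i) * poly p z"
        using True i by (subst sum_sylvester_row[OF assms(1) True, symmetric])
          (auto simp: sylvester_mat_sub_index)
      with assms show ?thesis by simp
    next
      case False
      then have "i - n < m" using i by simp
      have "(\<Sum>j<?N. ?S $$ (i, j) * z ^ (?N - 1 - j)) = z ^ (m - 1 - (i - n)) * poly q z"
        unfolding sum_sylvester_row[OF assms(2) \<open>i - n < m\<close>, symmetric]
        using False i by (intro sum.cong) (auto simp: sylvester_mat_sub_index add.commute)
      with assms show ?thesis by simp
    qed
    finally show "vec_index (?S *\<^sub>v v) i = vec_index (0\<^sub>v ?N) i" using i by simp
  qed auto
  \<comment> \<open>The last entry of \<open>v\<close> is z^0 = 1, so \<open>v\<close> is nonzero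
    even for z = 0.\<close>
  moreover have "vec_index v (?N - 1) \<noteq> vec_index (0\<^sub>v ?N) (?N - 1)"
    using assms(3) by (simp add: v_def)
  then have "v \<noteq> 0\<^sub>v ?N" by metis
  moreover have "v \<in> carrier_vec ?N" by (simp add: v_def)
  ultimately show ?thesis
    using det_0_iff_vec_prod_zero[OF sylvester_mat_sub_carrier] by blast
qed

section \<open>Thom's lemma and a bound on roots\<close>

text \<open>Induction on the degree bound: the derivative keeps a nonzero sign on the interval, so
  \<open>q\<close> is strictly monotone there. Its values therefore lie between those at the
  endpoints, which have the same sign.\<close>

lemma poly_constant_sign_on_interval:
  fixes q :: "real poly"
  assumes "x < y" "degree q \<le> d"
    and "\<And>i. i \<le> d \<Longrightarrow> poly ((pderiv ^^ i) q) x \<noteq> 0"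
    and "\<And>i. i \<le> d \<Longrightarrow> sgn (poly ((pderiv ^^ i) q) x) = sgn (poly ((pderiv ^^ i) q) y)"
    and "z \<in> {x..y}"
  shows "sgn (poly q z) = sgn (poly q x)"
  using assms
proof (induction d arbitrary: q z)
  case 0
  then obtain c where "q = [:c:]" using degree_eq_zeroE by blast
  then show ?case by simp
next
  case (Suc d)
  have pderiv_sign: "sgn (poly (pderiv q) w) = sgn (poly (pderiv q) x)" if "w \<in> {x..y}" for w
  proof (rule Suc.IH[OF \<open>x < y\<close>])
    show "degree (pderiv q) \<le> d" using Suc.prems(2) by (simp add: degree_pderiv)
    show "poly ((pderiv ^^ i) (pderiv q)) x \<noteq> 0" if "i \<le> d" for i
      using Suc.prems(3)[of "Suc i"] that by (simp add: funpow_swap1)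
    show "sgn (poly ((pderiv ^^ i) (pderiv q)) x) = sgn (poly ((pderiv ^^ i) (pderiv q)) y)"
      if "i \<le> d" for i
      using Suc.prems(4)[of "Suc i"] that by (simp add: funpow_swap1)
  qed fact
  have eq: "sgn (poly q x) = sgn (poly q y)" using Suc.prems(4)[of 0] by simp
  have mono: "sgn (poly q v - poly q u) = sgn (poly (pderiv q) x)"
    if "x \<le> u" "u < v" "v \<le> y" for u v
  proof -
    obtain w where w: "u < w" "w < v" "poly q v - poly q u = (v - u) * poly (pderiv q) w"
      using poly_MVT[OF \<open>u < v\<close>] by blast
    then show ?thesis using pderiv_sign[of w] that by (simp add: sgn_mult)
  qed
  show ?case
  proof (cases "z = x \<or> z = y")
    case True
    then show ?thesis using eq by auto
  next
    case False
    then have "x < z" "z < y" using Suc.prems(5) by auto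
    then have "sgn (poly q z - poly q x) = sgn (poly q y - poly q z)"
      using mono[of x z] mono[of z y] by simp
    then show ?thesis using eq by (auto simp: sgn_if split: if_splits)
  qed
qed

text \<open>Thom's lemma, in the case where no derivative vanishes at the two roots.\<close>

lemma roots_eq_if_pderiv_signs_eq:
  fixes q :: "real poly"
  assumes "degree q \<le> d" "1 \<le> d" "poly q x = 0" "poly q y = 0"
    and nz: "\<And>i. i \<in> {1..d} \<Longrightarrow> poly ((pderiv ^^ i) q) x \<noteq> 0"
    and sgn: "\<And>i. i \<in> {1..d} \<Longrightarrow> sgn (poly ((pderiv ^^ i) q) x) = sgn (poly ((pderiv ^^ i) q) y)"
  shows "x = y"
proof -
  have False if "x < y" and "poly q x = 0" "poly q y = 0"
    and nz: "\<And>i. i \<in> {1..d} \<Longrightarrow> poly ((pderiv ^^ i) q) x \<noteq> 0"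
    and sgn: "\<And>i. i \<in> {1..d} \<Longrightarrow> sgn (poly ((pderiv ^^ i) q) x) = sgn (poly ((pderiv ^^ i) q) y)"
  for x y
  proof -
    obtain w where w: "x < w" "w < y" "poly q y - poly q x = (y - x) * poly (pderiv q) w"
      using poly_MVT[OF \<open>x < y\<close>] by blast
    \<comment> \<open>Since \<open>x\<close> and \<open>y\<close> are both roots, \<open>w\<close>
      is a critical point. Applied to the derivative, the interval lemma forbids this, because the
      derivative is nonzero at \<open>x\<close>.\<close>
    have "sgn (poly (pderiv q) w) = sgn (poly (pderiv q) x)"
    proof (rule poly_constant_sign_on_interval[OF \<open>x < y\<close>, of _ "d - 1"])
      show "degree (pderiv q) \<le> d - 1" using assms(1) by (simp add: degree_pderiv)
    qed (use nz[of "Suc _"] sgn[of "Suc _"] w assms(2) in \<open>auto simp: funpow_swap1\<close>)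
    then show False using w that nz[of 1] assms(2) by (simp add: sgn_zero_iff)
  qed
  from this[of x y] this[of y x] show ?thesis
    using assms by (metis linorder_less_linear sgn_eq_0_iff)
qed

text \<open>For |z| > 1, isolate the leading term, bound each lower power by |z|^(d-1) and cancel
  that power. The bound is continuous in the coefficients while the leading one is nonzero, so roots
  stay bounded along convergent parameters.\<close>

lemma abs_root_le:
  fixes q :: "real poly"
  assumes "degree q = d" "1 \<le> d" "poly q z = 0"
  shows "\<bar>z\<bar> \<le> 1 + (\<Sum>i<d. \<bar>coeff q i\<bar>) / \<bar>coeff q d\<bar>"
proof (cases "\<bar>z\<bar> \<le> 1")
  case True
  moreover have "0 \<le> (\<Sum>i<d. \<bar>coeff q i\<bar>) / \<bar>coeff q d\<bar>" by (simp add: sum_nonneg)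
  ultimately show ?thesis by linarith
next
  case False
  have c: "\<bar>coeff q d\<bar> > 0" using assms by auto
  have "coeff q d * z ^ d = - (\<Sum>i<d. coeff q i * z ^ i)"
    using assms by (simp add: poly_altdef lessThan_Suc_atMost[symmetric])
  then have "\<bar>coeff q d\<bar> * \<bar>z\<bar> ^ d = \<bar>\<Sum>i<d. coeff q i * z ^ i\<bar>"
    by (simp flip: power_abs abs_mult)
  also have "\<dots> \<le> (\<Sum>i<d. \<bar>coeff q i\<bar> * \<bar>z\<bar> ^ i)"
    by (rule order_trans[OF sum_abs]) (simp add: abs_mult power_abs)
  also have "\<dots> \<le> (\<Sum>i<d. \<bar>coeff q i\<bar> * \<bar>z\<bar> ^ (d - 1))"
    using False by (intro sum_mono mult_left_mono power_increasing) auto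
  also have "\<dots> = (\<Sum>i<d. \<bar>coeff q i\<bar>) * \<bar>z\<bar> ^ (d - 1)"
    by (simp add: sum_distrib_right)
  finally have "(\<bar>coeff q d\<bar> * \<bar>z\<bar>) * \<bar>z\<bar> ^ (d - 1) \<le> (\<Sum>i<d. \<bar>coeff q i\<bar>) * \<bar>z\<bar> ^ (d - 1)"
    using assms(2) by (cases d) (auto simp: mult_ac)
  then have "\<bar>coeff q d\<bar> * \<bar>z\<bar> \<le> (\<Sum>i<d. \<bar>coeff q i\<bar>)"
    by (rule mult_right_le_imp_le) (use False in auto)
  then have "\<bar>z\<bar> \<le> (\<Sum>i<d. \<bar>coeff q i\<bar>) / \<bar>coeff q d\<bar>"
    unfolding pos_le_divide_eq[OF c] by (subst mult.commute)
  then show ?thesis by linarith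
qed

section \<open>Continuous families of real polynomials of constant degree\<close>

text \<open>These are the properties that the topological argument takes from the nonvanishing
  resultants: no drop of degree, and no derivative sharing a real root with the polynomial.\<close>

locale generic_poly_family =
  fixes f :: "'a::metric_space \<Rightarrow> real poly" and C :: "'a set" and d :: nat
  assumes degree_pos: "1 \<le> d"
    and degree_eq: "a \<in> C \<Longrightarrow> degree (f a) = d"
    and continuous_coeff: "continuous_on C (\<lambda>a. coeff (f a) j)"
    and pderiv_nonzero:
      "\<lbrakk>a \<in> C; poly (f a) z = 0; i \<in> {1..d}\<rbrakk> \<Longrightarrow> poly ((pderiv ^^ i) (f a)) z \<noteq> 0"
begin

text \<open>The sign vector \<open>s\<close> serves as a label of a root that keeps its meaning as
  the parameter varies.\<close>

definition root_with_signs :: "(nat \<Rightarrow> real) \<Rightarrow> 'a \<Rightarrow> real \<Rightarrow> bool" where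
  "root_with_signs s a z \<longleftrightarrow>
    poly (f a) z = 0 \<and> (\<forall>i\<in>{1..d}. sgn (poly ((pderiv ^^ i) (f a)) z) = s i)"

lemma root_with_signs_unique:
  "\<lbrakk>a \<in> C; root_with_signs s a z; root_with_signs s a w\<rbrakk> \<Longrightarrow> z = w"
  unfolding root_with_signs_def
  using roots_eq_if_pderiv_signs_eq[of "f a" d z w] degree_eq degree_pos pderiv_nonzero by simp

lemma continuous_on_poly_pderiv:
  "continuous_on (C \<times> UNIV) (\<lambda>x. poly ((pderiv ^^ i) (f (fst x))) (snd x))"
proof -
  \<comment> \<open>The uniform degree bound gives a sum of fixed length, so joint continuity in
    parameter and argument follows from continuity of the coefficients.\<close>
  have eq: "poly ((pderiv ^^ i) (f a)) z
      = (\<Sum>j\<le>d. (pochhammer (of_nat (Suc j)) i * coeff (f a) (j + i)) * z ^ j)" if "a \<in> C" for a z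
  proof -
    have "degree ((pderiv ^^ i) (f a)) \<le> d"
      by (induction i) (use degree_eq[OF that] in \<open>auto simp: degree_pderiv\<close>)
    then show ?thesis
      unfolding poly_altdef coeff_higher_pderiv[symmetric]
      by (intro sum.mono_neutral_left) (auto simp: coeff_eq_0)
  qed
  have "continuous_on (C \<times> UNIV) (\<lambda>x. coeff (f (fst x)) j)" for j
    by (rule continuous_on_compose2[OF continuous_coeff]) (auto intro!: continuous_intros)
  then have "continuous_on (C \<times> UNIV) (\<lambda>x. \<Sum>j\<le>d.
      (pochhammer (of_nat (Suc j)) i * coeff (f (fst x)) (j + i)) * snd x ^ j)"
    by (intro continuous_intros)
  then show ?thesis
    by (rule continuous_on_eq) (auto simp: eq)
qed

text \<open>Near (a, z) all derivatives of order at least 1 keep their signs. The polynomial at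
  \<open>a\<close> is thus strictly monotone near \<open>z\<close> and changes sign there. The sign
  change survives a small move of the parameter and yields a nearby root with the same
  signs.\<close>

lemma root_with_signs_near:
  assumes "a \<in> C" "root_with_signs s a z" "\<epsilon> > 0"
  shows "\<forall>\<^sub>F b in at a within C. \<exists>w. \<bar>w - z\<bar> < \<epsilon> \<and> root_with_signs s b w"
proof -
  let ?P = "\<lambda>i x. poly ((pderiv ^^ i) (f (fst x))) (snd x)"
  \<comment> \<open>Each \<open>s i\<close> is 1 or -1, so multiplying by it turns every sign
    condition into positivity.\<close>
  have s: "s i * poly ((pderiv ^^ i) (f a)) z > 0" "s i \<noteq> 0" if "i \<in> {1..d}" for i
  proof -
    have "s i = sgn (poly ((pderiv ^^ i) (f a)) z)" "poly ((pderiv ^^ i) (f a)) z \<noteq> 0"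
      using assms(2) pderiv_nonzero[OF assms(1) _ that] that by (auto simp: root_with_signs_def)
    then show "s i * poly ((pderiv ^^ i) (f a)) z > 0" "s i \<noteq> 0"
      by (simp_all add: sgn_if)
  qed
  have lim: "((\<lambda>x. s i * ?P i x) \<longlongrightarrow> s i * poly ((pderiv ^^ i) (f a)) z) (at (a, z) within C \<times> UNIV)"
    for i
    using continuous_on_poly_pderiv[of i] assms(1)
    by (intro tendsto_mult_left) (auto simp: continuous_on_def)
  have "\<forall>\<^sub>F x in at (a, z) within C \<times> UNIV. \<forall>i\<in>{1..d}. s i * ?P i x > 0"
    by (intro eventually_ball_finite ballI order_tendstoD(1)[OF lim] s) auto
  then obtain \<eta> where \<eta>: "\<eta> > 0" 
    "\<forall>x\<in>C \<times> UNIV. x \<noteq> (a, z) \<and> dist x (a, z) < \<eta> \<longrightarrow> (\<forall>i\<in>{1..d}. s i * ?P i x > 0)"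
    unfolding eventually_at by blast
  \<comment> \<open>Two distances below half of \<eta> add up to less than \<eta> in the product
    metric. The centre, which the punctured filter omits, is covered by \<open>s\<close>.\<close>
  have pos: "s i * poly ((pderiv ^^ i) (f b)) w > 0"
    if "b \<in> C" "dist b a < \<eta> / 2" "\<bar>w - z\<bar> < \<eta> / 2" "i \<in> {1..d}" for b w i
  proof (cases "(b, w) = (a, z)")
    case False
    have "dist (b, w) (a, z) \<le> dist b a + \<bar>w - z\<bar>"
      unfolding dist_Pair_Pair dist_real_def
      using sqrt_sum_squares_le_sum_abs[of "dist b a" "\<bar>w - z\<bar>"] by simp
    then have "dist (b, w) (a, z) < \<eta>" using that by linarith
    then show ?thesis using bspec[OF \<eta>(2), of "(b, w)"] False that by simp
  qed (use s that in auto)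
  \<comment> \<open>A quarter of \<eta> keeps the closed interval of radius \<open>h\<close>
    strictly inside the range of \<open>pos\<close>; half of \<epsilon> makes the new root strictly
    close enough.\<close>
  define h where "h = min (\<eta> / 4) (\<epsilon> / 2)"
  have h: "0 < h" "h < \<eta> / 2" "h < \<epsilon>" using \<eta> assms(3) by (auto simp: h_def)
  have d: "1 \<in> {1..d}" using degree_pos by simp
  have increasing: "s 1 * poly (f a) u < s 1 * poly (f a) v" if "z - h \<le> u" "u < v" "v \<le> z + h" for u v
  proof -
    obtain w where w: "u < w" "w < v" "poly (f a) v - poly (f a) u = (v - u) * poly (pderiv (f a)) w"
      using poly_MVT[OF \<open>u < v\<close>] by blast
    have "\<bar>w - z\<bar> < \<eta> / 2" using w that h by linarith
    then have "s 1 * poly (pderiv (f a)) w > 0" using pos[OF assms(1) _ _ d, of w] \<eta>(1) by simp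
    then have "0 < (v - u) * (s 1 * poly (pderiv (f a)) w)" using \<open>u < v\<close> by simp
    also have "\<dots> = s 1 * (poly (f a) v - poly (f a) u)" by (simp add: w(3))
    finally have "s 1 * (poly (f a) v - poly (f a) u) > 0" .
    then show ?thesis by (simp add: algebra_simps)
  qed
  have root: "poly (f a) z = 0" using assms(2) by (simp add: root_with_signs_def)
  have lim0: "((\<lambda>b. s 1 * poly (f b) u) \<longlongrightarrow> s 1 * poly (f a) u) (at a within C)" for u
  proof -
    have "continuous_on C (\<lambda>b. poly (f b) u)"
      using continuous_on_compose2[OF continuous_on_poly_pderiv[of 0], of C "\<lambda>b. (b, u)"]
      by (simp add: continuous_on_Pair image_subset_iff)
    then show ?thesis using assms(1) by (intro tendsto_mult_left) (auto simp: continuous_on_def)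
  qed
  have "\<forall>\<^sub>F b in at a within C. s 1 * poly (f b) (z - h) < 0"
    using increasing[of "z - h" z] root h by (intro order_tendstoD(2)[OF lim0]) auto
  moreover have "\<forall>\<^sub>F b in at a within C. s 1 * poly (f b) (z + h) > 0"
    using increasing[of z "z + h"] root h by (intro order_tendstoD(1)[OF lim0]) auto
  moreover have "\<forall>\<^sub>F b in at a within C. b \<in> C \<and> dist b a < \<eta> / 2"
    unfolding eventually_at using \<eta>(1) by (intro exI[of _ "\<eta> / 2"]) auto
  ultimately show ?thesis
  proof eventually_elim
    case (elim b)
    \<comment> \<open>After scaling by \<open>s 1\<close> the sign change always goes from negative
      to positive, so one form of the intermediate value theorem covers both cases.\<close>
    then have "poly (Polynomial.smult (s 1) (f b)) (z - h) < 0"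
      and "0 < poly (Polynomial.smult (s 1) (f b)) (z + h)" by auto
    moreover have "z - h < z + h" using h(1) by simp
    ultimately obtain w where w: "z - h < w" "w < z + h" "poly (Polynomial.smult (s 1) (f b)) w = 0"
      using poly_IVT_pos by blast
    then have "\<bar>w - z\<bar> < h" by linarith
    have "sgn (poly ((pderiv ^^ i) (f b)) w) = s i" if "i \<in> {1..d}" for i
    proof -
      have "s i * poly ((pderiv ^^ i) (f b)) w > 0" using elim \<open>\<bar>w - z\<bar> < h\<close> h that by (intro pos) auto
      moreover have "s i = sgn (poly ((pderiv ^^ i) (f a)) z)"
        using assms(2) that by (simp add: root_with_signs_def)
      then have "s i = 1 \<or> s i = - 1" using s(2)[OF that] by (simp add: sgn_if split: if_splits)
      ultimately show ?thesis by auto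
    qed
    with w s(2)[OF d] h show ?case by (intro exI[of _ w]) (auto simp: root_with_signs_def)
  qed
qed

text \<open>The roots stay bounded along the sequence, so a subsequence of them converges to some
  \<open>w\<close>. By joint continuity \<open>w\<close> is a root over \<open>a\<close>; no
  derivative vanishes there, so the signs pass to the limit.\<close>

lemma root_with_signs_limit:
  assumes "\<And>n. x n \<in> C" "x \<longlonglongrightarrow> a" "a \<in> C" "\<And>n. root_with_signs s (x n) (z n)"
  shows "\<exists>w. root_with_signs s a w"
proof -
  define B where "B = (\<lambda>a. 1 + (\<Sum>i<d. \<bar>coeff (f a) i\<bar>) / \<bar>coeff (f a) d\<bar>)"
  have "coeff (f b) d \<noteq> 0" if "b \<in> C" for b
    using degree_eq[OF that] degree_pos by auto
  then have "continuous_on C B"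
    unfolding B_def by (intro continuous_intros continuous_coeff) auto
  then have "(\<lambda>n. B (x n)) \<longlonglongrightarrow> B a"
    using assms by (intro continuous_on_tendsto_compose[of C B]) auto
  then have "bounded (range (\<lambda>n. B (x n)))"
    by (rule convergent_imp_bounded)
  then obtain M where M: "\<And>n. \<bar>B (x n)\<bar> \<le> M"
    unfolding bounded_iff by auto
  have "\<bar>z n\<bar> \<le> B (x n)" for n
    unfolding B_def using abs_root_le[of "f (x n)" d "z n"] assms degree_eq degree_pos
    by (auto simp: root_with_signs_def)
  then have "z n \<in> {- M..M}" for n using M[of n] by (smt (verit) atLeastAtMost_iff)
  then obtain w r where r: "strict_mono r" "(z \<circ> r) \<longlonglongrightarrow> w"
    using compact_Icc[of "- M" M] unfolding compact_def by metis
  have lim: "(\<lambda>n. poly ((pderiv ^^ i) (f (x (r n)))) (z (r n))) \<longlonglongrightarrow> poly ((pderiv ^^ i) (f a)) w" for i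
  proof -
    have "(\<lambda>n. (x (r n), z (r n))) \<longlonglongrightarrow> (a, w)"
      using r LIMSEQ_subseq_LIMSEQ[OF assms(2) r(1)] by (intro tendsto_Pair) (auto simp: comp_def)
    from continuous_on_tendsto_compose[OF continuous_on_poly_pderiv[of i] this]
    show ?thesis using assms by simp
  qed
  have root: "poly (f a) w = 0"
    using lim[of 0] assms(4) by (simp add: root_with_signs_def LIMSEQ_const_iff)
  moreover have "sgn (poly ((pderiv ^^ i) (f a)) w) = s i" if i: "i \<in> {1..d}" for i
    using tendsto_sgn[OF lim pderiv_nonzero[OF assms(3) root i]] assms(4) i
    by (simp add: root_with_signs_def LIMSEQ_const_iff)
  ultimately show ?thesis unfolding root_with_signs_def by blast
qed

lemma root_with_signs_all:
  assumes "connected C" "a \<in> C" "b \<in> C" "root_with_signs s a z"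
  shows "\<exists>w. root_with_signs s b w"
proof -
  let ?D = "{c \<in> C. \<exists>w. root_with_signs s c w}"
  have "openin (top_of_set C) ?D"
  proof -
    have "\<exists>\<delta>>0. \<forall>c\<in>C. dist c a < \<delta> \<longrightarrow> c \<in> ?D" if "a \<in> ?D" for a
    proof -
      from that obtain z where "a \<in> C" "root_with_signs s a z" by blast
      then have "\<forall>\<^sub>F b in at a within C. \<exists>w. \<bar>w - z\<bar> < 1 \<and> root_with_signs s b w"
        by (rule root_with_signs_near) simp
      then have "\<forall>\<^sub>F b in at a within C. \<exists>w. root_with_signs s b w"
        by (rule eventually_mono) blast
      then obtain \<delta> where "\<delta> > 0"
        and \<delta>: "\<forall>c\<in>C. c \<noteq> a \<and> dist c a < \<delta> \<longrightarrow> (\<exists>w. root_with_signs s c w)"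
        unfolding eventually_at by (elim exE conjE)
      \<comment> \<open>The punctured filter says nothing about the centre, which lies in the set by
        assumption.\<close>
      then have "c \<in> ?D" if "c \<in> C" "dist c a < \<delta>" for c
        using \<open>a \<in> ?D\<close> that by (cases "c = a") simp_all
      with \<open>\<delta> > 0\<close> show ?thesis by blast
    qed
    then show ?thesis unfolding openin_euclidean_subtopology_iff by blast
  qed
  moreover have "closedin (top_of_set C) ?D"
    unfolding closedin_limpt
  proof (intro conjI allI impI)
    fix c assume c: "c islimpt ?D \<and> c \<in> C"
    then obtain x where x: "\<And>n. x n \<in> ?D" "x \<longlonglongrightarrow> c"
      unfolding islimpt_sequential by blast
    then have "\<forall>n. \<exists>z. root_with_signs s (x n) z" by simp
    then obtain z where "\<And>n. root_with_signs s (x n) (z n)" by metis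
    from root_with_signs_limit[OF _ x(2) _ this] show "c \<in> ?D" using x c by blast
  qed auto
  ultimately have "?D = {} \<or> ?D = C" using assms(1) unfolding connected_clopen by blast
  then show ?thesis using assms by blast
qed

text \<open>Persistence gives over each nearby \<open>b\<close> a root close to \<open>g a\<close>
  with the same signs, and uniqueness identifies it with \<open>g b\<close>.\<close>

lemma continuous_on_root_with_signs:
  assumes "\<And>a. a \<in> C \<Longrightarrow> root_with_signs s a (g a)"
  shows "continuous_on C g"
  unfolding continuous_on_def
proof (intro ballI tendstoI)
  fix a and e :: real assume "a \<in> C" "e > 0"
  have "\<forall>\<^sub>F b in at a within C. b \<in> C" by (simp add: eventually_at_filter)
  then show "\<forall>\<^sub>F b in at a within C. dist (g b) (g a) < e"
    using root_with_signs_near[OF \<open>a \<in> C\<close> assms[OF \<open>a \<in> C\<close>] \<open>e > 0\<close>]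
  proof eventually_elim
    case (elim b)
    then show ?case using root_with_signs_unique[of b s "g b"] assms unfolding dist_real_def by blast
  qed
qed

theorem roots_parametrized:
  assumes "connected C" "a\<^sub>0 \<in> C"
  shows "\<exists>(k::nat) r \<sigma>.
    (\<forall>j\<in>{1..k}. continuous_on C (r j)) \<and>
    (\<forall>a\<in>C. \<forall>j\<in>{1..k}. \<forall>l\<in>{1..k}. j < l \<longrightarrow> r j a < r l a) \<and>
    (\<forall>a\<in>C. {z. poly (f a) z = 0} = (\<lambda>j. r j a) ` {1..k}) \<and>
    (\<forall>a\<in>C. \<forall>j\<in>{1..k}. \<forall>z. z = r j a \<longleftrightarrow> root_with_signs (\<lambda>i. \<sigma> i j) a z)"
proof -
  define Z where "Z = {z. poly (f a\<^sub>0) z = 0}"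
  have "f a\<^sub>0 \<noteq> 0" using degree_eq[OF assms(2)] degree_pos by auto
  then have "finite Z" unfolding Z_def by (rule poly_roots_finite)
  define k where "k = card Z"
  \<comment> \<open>The roots over the base point in increasing order, counted from 1 while lists
    count from 0.\<close>
  define \<rho> where "\<rho> = (\<lambda>j. sorted_list_of_set Z ! (j - 1))"
  have len: "length (sorted_list_of_set Z) = k" by (simp add: k_def)
  have \<rho>_less: "\<rho> j < \<rho> l" if "j \<in> {1..k}" "l \<in> {1..k}" "j < l" for j l
    unfolding \<rho>_def using that len
    by (intro sorted_wrt_nth_less[OF strict_sorted_list_of_set]) auto
  have "{1..k} = Suc ` {0..<k}"
    by (simp add: image_Suc_atLeastLessThan atLeastLessThanSuc_atLeastAtMost)
  then have "\<rho> ` {1..k} = (!) (sorted_list_of_set Z) ` {0..<k}"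
    by (simp only: \<rho>_def image_image diff_Suc_1)
  also have "\<dots> = Z"
    using nth_image[of k "sorted_list_of_set Z"] len \<open>finite Z\<close> by simp
  finally have \<rho>_image: "\<rho> ` {1..k} = Z" .
  define \<sigma> where "\<sigma> = (\<lambda>i j. sgn (poly ((pderiv ^^ i) (f a\<^sub>0)) (\<rho> j)))"
  have \<rho>: "root_with_signs (\<lambda>i. \<sigma> i j) a\<^sub>0 (\<rho> j)" if "j \<in> {1..k}" for j
    using \<rho>_image that by (auto simp: root_with_signs_def \<sigma>_def Z_def)
  define r where "r = (\<lambda>j a. THE z. root_with_signs (\<lambda>i. \<sigma> i j) a z)"
  have r: "root_with_signs (\<lambda>i. \<sigma> i j) a (r j a)" if j: "j \<in> {1..k}" and a: "a \<in> C" for j a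
  proof -
    obtain z where "root_with_signs (\<lambda>i. \<sigma> i j) a z"
      using root_with_signs_all[OF assms a \<rho>[OF j]] by blast
    then show ?thesis
      unfolding r_def using root_with_signs_unique[OF a] by (metis theI)
  qed
  have r_iff: "z = r j a \<longleftrightarrow> root_with_signs (\<lambda>i. \<sigma> i j) a z" if "j \<in> {1..k}" "a \<in> C" for j a z
    using r[OF that] root_with_signs_unique[OF that(2)] by blast
  have r_a0: "r j a\<^sub>0 = \<rho> j" if "j \<in> {1..k}" for j
    using r_iff[OF that assms(2), of "\<rho> j"] \<rho>[OF that] by simp
  have cont: "continuous_on C (r j)" if "j \<in> {1..k}" for j
    using r[OF that] by (rule continuous_on_root_with_signs)
  have less: "r j a < r l a" if j: "j \<in> {1..k}" and l: "l \<in> {1..k}" and "j < l" "a \<in> C" for j l a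
  proof (rule ccontr)
    \<comment> \<open>The difference of the two root functions is positive at the base point and
      nonpositive at \<open>a\<close>, so it vanishes at some \<open>b\<close>. The common root
      there carries both sign vectors, which must therefore agree, and then the two base roots
      coincide.\<close>
    assume "\<not> r j a < r l a"
    moreover have "r l a\<^sub>0 - r j a\<^sub>0 > 0" using \<rho>_less j l \<open>j < l\<close> r_a0 by simp
    moreover have conn: "connected ((\<lambda>a. r l a - r j a) ` C)"
      by (intro connected_continuous_image continuous_intros cont j l assms)
    ultimately have "0 \<in> (\<lambda>a. r l a - r j a) ` C"
      using connectedD_interval[OF conn imageI[OF \<open>a \<in> C\<close>] imageI[OF assms(2)], of 0] by simp
    then obtain b where b: "b \<in> C" "r l b = r j b" by auto
    have "root_with_signs (\<lambda>i. \<sigma> i l) a\<^sub>0 (\<rho> j)"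
      using r[OF j b(1)] r[OF l b(1)] \<rho>[OF j] b(2) by (simp add: root_with_signs_def)
    then have "\<rho> j = \<rho> l" using \<rho>[OF l] root_with_signs_unique assms(2) by blast
    then show False using \<rho>_less[OF j l \<open>j < l\<close>] by simp
  qed
  have roots: "{z. poly (f a) z = 0} = (\<lambda>j. r j a) ` {1..k}" if a: "a \<in> C" for a
  proof
    show "(\<lambda>j. r j a) ` {1..k} \<subseteq> {z. poly (f a) z = 0}"
      using r[OF _ a] by (auto simp: root_with_signs_def)
    show "{z. poly (f a) z = 0} \<subseteq> (\<lambda>j. r j a) ` {1..k}"
    proof
      fix z assume "z \<in> {z. poly (f a) z = 0}"
      \<comment> \<open>Every root over \<open>a\<close> is labelled by its own signs. Carried back
        to the base point, this label belongs to some \<rho> \<open>j\<close>, so the given root is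
        \<open>r j a\<close>.\<close>
      then have z: "root_with_signs (\<lambda>i. sgn (poly ((pderiv ^^ i) (f a)) z)) a z"
        by (simp add: root_with_signs_def)
      then obtain w where w: "root_with_signs (\<lambda>i. sgn (poly ((pderiv ^^ i) (f a)) z)) a\<^sub>0 w"
        using root_with_signs_all[OF assms(1) a assms(2)] by blast
      then have "w \<in> \<rho> ` {1..k}" unfolding \<rho>_image Z_def root_with_signs_def by simp
      then obtain j where j: "j \<in> {1..k}" "w = \<rho> j" by blast
      have "root_with_signs (\<lambda>i. \<sigma> i j) a z"
        using z w \<rho>[OF j(1)] j(2) by (simp add: root_with_signs_def)
      then show "z \<in> (\<lambda>j. r j a) ` {1..k}" using r_iff[OF j(1) a] j(1) by blast
    qed
  qed
  show ?thesis
    by (intro exI[of _ k] exI[of _ r] exI[of _ \<sigma>] conjI ballI allI impI cont less roots r_iff)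
qed

end

section \<open>Specialization and the resultant conditions\<close>

lemma coeff_specialize: "coeff (specialize a p) i = mpoly_eval a (coeff p i)"
  by (simp add: specialize_def coeff_map_poly)

lemma specialize_higher_pderiv:
  fixes p :: "'n::{finite,linorder} mpoly_rat poly"
  shows "specialize a ((pderiv ^^ i) p) = (pderiv ^^ i) (specialize a p)"
  unfolding specialize_def by (rule idom_hom.map_poly_higher_pderiv[OF idom_hom_mpoly_eval])

text \<open>Evaluation commutes with the determinant. The specialized matrix keeps the format given
  by the degrees of \<open>p\<close> and \<open>q\<close>, even where the specialized degrees
  drop.\<close>

lemma mpoly_eval_resultant_common_root:
  fixes p q :: "'n::{finite,linorder} mpoly_rat poly"
  assumes "0 < degree p" "poly (specialize a p) z = 0" "poly (specialize a q) z = 0"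
  shows "mpoly_eval a (resultant p q) = 0"
proof -
  interpret idom_hom "mpoly_eval a :: 'n mpoly_rat \<Rightarrow> real" by (rule idom_hom_mpoly_eval)
  have "mpoly_eval a (resultant p q)
      = det (sylvester_mat_sub (degree p) (degree q) (specialize a p) (specialize a q))"
    unfolding resultant_def sylvester_mat_def specialize_def
    by (simp add: hom_det[symmetric] sylvester_mat_sub_map)
  also have "\<dots> = 0"
    using assms by (intro det_sylvester_mat_sub_common_root[where z = z])
      (auto simp: specialize_def degree_map_poly_le)
  finally show ?thesis .
qed

text \<open>The \<open>d\<close>-th derivative is the constant d! times the leading coefficient, and
  the resultant with a constant is its \<open>d\<close>-th power. Contrapositively, the condition
  for i = d prevents a drop of degree.\<close>

lemma mpoly_eval_lead_coeff_eq_0: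
  fixes p :: "'n::{finite,linorder} mpoly_rat poly"
  assumes "degree p = d" "1 \<le> d" "mpoly_eval a (coeff p d) = 0"
  shows "mpoly_eval a (resultant p ((pderiv ^^ d) p)) = 0"
proof -
  interpret idom_hom "mpoly_eval a :: 'n mpoly_rat \<Rightarrow> real" by (rule idom_hom_mpoly_eval)
  have "(pderiv ^^ d) p = [:coeff ((pderiv ^^ d) p) 0:]"
    by (rule poly_eqI) (auto simp: coeff_higher_pderiv coeff_pCons coeff_eq_0 assms(1) split: nat.split)
  then have "resultant p ((pderiv ^^ d) p) = coeff ((pderiv ^^ d) p) 0 ^ d"
    using assms(1) resultant_const(2) by metis
  then show ?thesis
    using assms by (simp add: hom_power hom_mult coeff_higher_pderiv)
qed

theorem theorem3:
  fixes p :: "'n::{finite,linorder} mpoly_rat poly"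
    and d :: nat
    and A :: "(real ^ 'n::{finite,linorder}) set"
  assumes deg: "degree p = d" and d_pos: "d \<ge> 1"
    and A_eq: "A = {a. \<forall>i\<in>{1..d}. mpoly_eval a (resultant p ((pderiv ^^ i) p)) \<noteq> 0}"
  shows "open A \<and>
    (\<forall>C\<in>components A. \<exists>(k::nat) (r :: nat \<Rightarrow> real ^ 'n::{finite,linorder} \<Rightarrow> real).
       (\<forall>j\<in>{1..k}. continuous_on C (r j)) \<and>
       (\<forall>a\<in>C. \<forall>j\<in>{1..k}. \<forall>l\<in>{1..k}. j < l \<longrightarrow> r j a < r l a) \<and>
       (\<forall>a\<in>C. {z::real. poly (specialize a p) z = 0} = (\<lambda>j. r j a) ` {1..k}) \<and>
       (\<exists>\<sigma> :: nat \<Rightarrow> nat \<Rightarrow> real.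
          (\<forall>i\<in>{1..d}. \<forall>j\<in>{1..k}. \<sigma> i j \<noteq> 0 \<and>
             (\<forall>a\<in>C. sgn (poly (specialize a ((pderiv ^^ i) p)) (r j a)) = \<sigma> i j)) \<and>
          (\<forall>a\<in>C. \<forall>z::real. \<forall>j\<in>{1..k}.
             z = r j a \<longleftrightarrow>
               poly (specialize a p) z = 0 \<and>
               (\<forall>i\<in>{1..d}. sgn (poly (specialize a ((pderiv ^^ i) p)) z) = \<sigma> i j))))"
proof (intro conjI ballI)
  have "A = (\<Inter>i\<in>{1..d}. {a. mpoly_eval a (resultant p ((pderiv ^^ i) p)) \<noteq> 0})"
    unfolding A_eq by auto
  moreover have "open {a. mpoly_eval a (resultant p ((pderiv ^^ i) p)) \<noteq> 0}" for i
    by (intro open_Collect_neq continuous_on_mpoly_eval continuous_on_const)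
  ultimately show "open A" by auto
next
  fix C assume "C \<in> components A"
  then have "connected C" "C \<noteq> {}" "C \<subseteq> A"
    using in_components_connected in_components_nonempty in_components_subset by blast+
  then obtain a\<^sub>0 where "a\<^sub>0 \<in> C" by blast
  have nz: "mpoly_eval a (resultant p ((pderiv ^^ i) p)) \<noteq> 0" if "a \<in> C" "i \<in> {1..d}" for a i
    using that \<open>C \<subseteq> A\<close> A_eq by auto
  interpret generic_poly_family "\<lambda>a. specialize a p" C d
  proof
    show "1 \<le> d" by fact
    fix a assume a: "a \<in> C"
    have "coeff (specialize a p) d \<noteq> 0"
      using nz[OF a, of d] mpoly_eval_lead_coeff_eq_0[OF deg d_pos] d_pos
      by (auto simp: coeff_specialize)
    then show "degree (specialize a p) = d"
      using le_degree degree_map_poly_le[of "mpoly_eval a" p] deg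
      by (metis antisym specialize_def)
    show "poly ((pderiv ^^ i) (specialize a p)) z \<noteq> 0"
      if "poly (specialize a p) z = 0" "i \<in> {1..d}" for z i
      using mpoly_eval_resultant_common_root[of p a z "(pderiv ^^ i) p"] nz[OF a that(2)] that(1)
        deg d_pos by (auto simp: specialize_higher_pderiv)
  next
    show "continuous_on C (\<lambda>a. coeff (specialize a p) j)" for j
      unfolding coeff_specialize by (rule continuous_on_mpoly_eval)
  qed
  obtain k :: nat and r \<sigma> where r: "\<forall>j\<in>{1..k}. continuous_on C (r j)"
      "\<forall>a\<in>C. \<forall>j\<in>{1..k}. \<forall>l\<in>{1..k}. j < l \<longrightarrow> r j a < r l a"
      "\<forall>a\<in>C. {z. poly (specialize a p) z = 0} = (\<lambda>j. r j a) ` {1..k}"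
    and \<sigma>: "\<forall>a\<in>C. \<forall>j\<in>{1..k}. \<forall>z. z = r j a \<longleftrightarrow> root_with_signs (\<lambda>i. \<sigma> i j) a z"
    using roots_parametrized[OF \<open>connected C\<close> \<open>a\<^sub>0 \<in> C\<close>]
    by (elim exE conjE)
  have rws: "root_with_signs (\<lambda>i. \<sigma> i j) a (r j a)" if "a \<in> C" "j \<in> {1..k}" for a j
    using \<sigma> that by blast
  have sgn: "sgn (poly ((pderiv ^^ i) (specialize a p)) (r j a)) = \<sigma> i j"
    if "a \<in> C" "j \<in> {1..k}" "i \<in> {1..d}" for a i j
    using rws[OF that(1,2)] that(3) by (simp add: root_with_signs_def)
  \<comment> \<open>The signs do not depend on the point of \<open>C\<close>, so it suffices to look
    at the base point.\<close>
  have "\<sigma> i j \<noteq> 0" if "j \<in> {1..k}" "i \<in> {1..d}" for i j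
    using rws[OF \<open>a\<^sub>0 \<in> C\<close> that(1)] pderiv_nonzero[OF \<open>a\<^sub>0 \<in> C\<close> _ that(2), of "r j a\<^sub>0"]
      sgn[OF \<open>a\<^sub>0 \<in> C\<close> that] by (auto simp: root_with_signs_def sgn_eq_0_iff)
  with sgn r \<sigma> show "\<exists>(k::nat) r. 
       (\<forall>j\<in>{1..k}. continuous_on C (r j)) \<and>
       (\<forall>a\<in>C. \<forall>j\<in>{1..k}. \<forall>l\<in>{1..k}. j < l \<longrightarrow> r j a < r l a) \<and>
       (\<forall>a\<in>C. {z::real. poly (specialize a p) z = 0} = (\<lambda>j. r j a) ` {1..k}) \<and>
       (\<exists>\<sigma> :: nat \<Rightarrow> nat \<Rightarrow> real.
          (\<forall>i\<in>{1..d}. \<forall>j\<in>{1..k}. \<sigma> i j \<noteq> 0 \<and>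
             (\<forall>a\<in>C. sgn (poly (specialize a ((pderiv ^^ i) p)) (r j a)) = \<sigma> i j)) \<and>
          (\<forall>a\<in>C. \<forall>z::real. \<forall>j\<in>{1..k}.
             z = r j a \<longleftrightarrow>
               poly (specialize a p) z = 0 \<and>
               (\<forall>i\<in>{1..d}. sgn (poly (specialize a ((pderiv ^^ i) p)) z) = \<sigma> i j)))"
    unfolding specialize_higher_pderiv root_with_signs_def
    by (intro exI[of _ k] exI[of _ r] exI[of _ \<sigma>] conjI ballI allI) simp_all
qed

end
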